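(* Consider the system $\dot{x}(t) = f(t,x(t)) + g(t,x(t))u(t)$ with $x(t)\in\mathbb{R}^n$, $u(t)\in\mathbb{R}^m$, where $f:\mathbb{R}\times\mathbb{R}^n\to\mathbb{R}^n$ and $g:\mathbb{R}\times\mathbb{R}^n\to\mathbb{R}^{n\times m}$ are continuous in $t$ and locally Lipschitz in $x$. Let an initial time $t_0$, a terminal time $T\ge t_0$, a function $r:\mathbb{R}\times\mathbb{R}^n\to\mathbb{R}$ with associated target tube $\Omega_{t,0}^{r}$, and $\gamma\in\mathbb{R}$ be given. Suppose there exist a $\mathcal{C}^1$ function $V:\mathbb{R}\times\mathbb{R}^n\to\mathbb{R}$ and a control law $k:\mathbb{R}\times\mathbb{R}^n\to\mathbb{R}^m$ that is continuous in $t$ and locally Lipschitz in $x$, such that $$\frac{\partial V}{\partial t}(t,x) + \frac{\partial V}{\partial x}(t,x)\left( f(t,x) + g(t,x)k(t,x) \right) \leq 0 \quad \text{for all } (t, x) \in [t_0, T] \times \mathbb{R}^n,$$ and $$\Omega^V_{t,\gamma} \subseteq \Omega_{t,0}^{r} \quad \text{for all } t \in [t_0, T].$$ Then, under the control law $k$ (i.e. with $u(t)=k(t,x(t))$), any trajectory of the system with initial condition $x(t_0) \in \Omega_{t_0, \gamma}^V$ satisfies $\phi(t; t_0, x(t_0), k) \in \Omega_{t, 0}^{r}$ for all $t \in [t_0, T]$.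
   Context: For $\eta\in\mathbb{R}$ and a continuous function $r:\mathbb{R}\times\mathbb{R}^n\to\mathbb{R}$, $\Omega_{t,\eta}^{r} := \{x\in\mathbb{R}^n : r(t,x)\le\eta\}$, a $t$-dependent set. The target tube is the time-varying set $\Omega_{t,0}^r$ defined by the given function $r$. $\phi(t;t_0,x_0,u)$ denotes the solution of the system at time $t$ ($t_0\le t\le T$) from the initial condition $x_0$ at time $t_0$ under the control action $u$; $\phi(t;t_0,x_0,k)$ is the solution when $u(t)=k(t,x(t))$. $\mathcal{C}^1$ is the set of differentiable functions with continuous derivative. $\frac{\partial V}{\partial x}$ is the row vector of partial derivatives of $V$ with respect to $x$. *)

theory Defs
  imports "HOL-Analysis.Analysis"
begin

(* Functions on R x R^n are curried: the time argument comes first. *)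

definition sublevel :: "(real \<Rightarrow> real ^ 'n \<Rightarrow> real) \<Rightarrow> real \<Rightarrow> real \<Rightarrow> (real ^ 'n) set" where
  "sublevel r t \<eta> = {x. r t x \<le> \<eta>}"

(* local_lipschitz asks for a Lipschitz constant in x that is locally uniform in t,
   the usual well-posedness condition for time-varying differential equations. *)
definition cont_t_lipschitz_x :: "(real \<Rightarrow> real ^ 'n \<Rightarrow> 'b::metric_space) \<Rightarrow> bool" where
  "cont_t_lipschitz_x F \<longleftrightarrow>
     (\<forall>x. continuous_on UNIV (\<lambda>t. F t x)) \<and> local_lipschitz UNIV UNIV F"

definition C1 :: "('a::real_normed_vector \<Rightarrow> 'b::real_normed_vector) \<Rightarrow> bool" where
  "C1 F \<longleftrightarrow> (\<exists>F' :: 'a \<Rightarrow> 'a \<Rightarrow>\<^sub>L 'b.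
     (\<forall>z. (F has_derivative blinfun_apply (F' z)) (at z)) \<and> continuous_on UNIV F')"

definition partial_t :: "(real \<Rightarrow> real ^ 'n \<Rightarrow> real) \<Rightarrow> real \<Rightarrow> real ^ 'n \<Rightarrow> real" where
  "partial_t V t x = deriv (\<lambda>s. V s x) t"

(* The row vector of partial derivatives in x is an element of real ^ 'n;
   its product with a column vector is the inner product. *)
definition partial_x :: "(real \<Rightarrow> real ^ 'n \<Rightarrow> real) \<Rightarrow> real \<Rightarrow> real ^ 'n \<Rightarrow> real ^ 'n" where
  "partial_x V t x = (\<chi> i. deriv (\<lambda>h. V t (x + h *\<^sub>R axis i 1)) 0)"

(* \<phi> is a solution on all of {t0..T}; the derivatives at t0 and T are one-sided. *)
definition trajectory ::
  "(real \<Rightarrow> real ^ 'n \<Rightarrow> real ^ 'n) \<Rightarrow> (real \<Rightarrow> real ^ 'n \<Rightarrow> real ^ 'm ^ 'n) \<Rightarrow>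
   real \<Rightarrow> real \<Rightarrow> real ^ 'n \<Rightarrow> (real \<Rightarrow> real ^ 'm) \<Rightarrow> (real \<Rightarrow> real ^ 'n) \<Rightarrow> bool" where
  "trajectory f g t0 T x0 u \<phi> \<longleftrightarrow> \<phi> t0 = x0 \<and>
     (\<forall>t\<in>{t0..T}. (\<phi> has_vector_derivative (f t (\<phi> t) + g t (\<phi> t) *v u t)) (at t within {t0..T}))"

definition closed_loop_trajectory ::
  "(real \<Rightarrow> real ^ 'n \<Rightarrow> real ^ 'n) \<Rightarrow> (real \<Rightarrow> real ^ 'n \<Rightarrow> real ^ 'm ^ 'n) \<Rightarrow>
   real \<Rightarrow> real \<Rightarrow> real ^ 'n \<Rightarrow> (real \<Rightarrow> real ^ 'n \<Rightarrow> real ^ 'm) \<Rightarrow> (real \<Rightarrow> real ^ 'n) \<Rightarrow> bool" where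
  "closed_loop_trajectory f g t0 T x0 k \<phi> \<longleftrightarrow> trajectory f g t0 T x0 (\<lambda>t. k t (\<phi> t)) \<phi>"

end

theory Submission
  imports Defs
begin

text \<open>V acts as a Lyapunov-type certificate. Along a closed-loop trajectory \<phi>, the chain
  rule identifies the left side of the dissipation inequality with the time derivative of
  \<open>V t (\<phi> t)\<close>. By the mean value theorem this quantity never exceeds its initial
  value, which is at most \<gamma>; so \<phi> stays in the \<gamma>-sublevel sets of V, and these
  lie in the tube. The lemma \<open>has_derivative_partials\<close> supplies the link between the
  total derivative given by \<open>C1\<close> and the partial derivatives, which are defined one
  coordinate at a time through \<open>deriv\<close>.\<close>

lemma has_derivative_partials:
  fixes V :: "real \<Rightarrow> real ^ 'n \<Rightarrow> real"
  assumes D: "((\<lambda>(t, x). V t x) has_derivative D) (at (t, x))"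
  shows "D (a, w) = a * partial_t V t x + partial_x V t x \<bullet> w"
proof -
  interpret bounded_linear D
    using D by (rule has_derivative_bounded_linear)
  have "((\<lambda>s. (s, x)) has_derivative (\<lambda>h. (h, 0))) (at t)"
    by (intro has_derivative_Pair has_derivative_ident has_derivative_const)
  from has_derivative_compose[OF this D]
  have "((\<lambda>s. V s x) has_derivative (\<lambda>h. D (h, 0))) (at t)"
    by simp
  \<comment> \<open>A linear map on the reals is multiplication by its value at 1; this is the shape
    that \<open>has_field_derivative\<close> expects.\<close>
  moreover have "(\<lambda>h. D (h, 0)) = (*) (D (1, 0))"
  proof
    show "D (h, 0) = D (1, 0) * h" for h
      using scaleR[of h "(1, 0)"] by simp
  qed
  ultimately have pt: "partial_t V t x = D (1, 0)"
    unfolding partial_t_def by (simp only: DERIV_imp_deriv has_field_derivative_def)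
  have px: "partial_x V t x $ i = D (0, axis i 1)" for i
  proof -
    have "((\<lambda>h. (t, x + h *\<^sub>R axis i 1)) has_derivative (\<lambda>h. (0, h *\<^sub>R axis i 1))) (at 0)"
      by (intro derivative_eq_intros) (auto)
    from has_derivative_compose[OF this, of "\<lambda>(t, x). V t x" D]
    have "((\<lambda>h. V t (x + h *\<^sub>R axis i 1)) has_derivative (\<lambda>h. D (0, h *\<^sub>R axis i 1))) (at 0)"
      using D by simp
    moreover have "(\<lambda>h. D (0, h *\<^sub>R axis i 1)) = (*) (D (0, axis i 1))"
    proof
      show "D (0, h *\<^sub>R axis i 1) = D (0, axis i 1) * h" for h
        using scaleR[of h "(0, axis i 1)"] by simp
    qed
    ultimately show ?thesis
      unfolding partial_x_def by (simp add: DERIV_imp_deriv has_field_derivative_def)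
  qed
  \<comment> \<open>Linearity of D reduces the claim to the coordinate directions, where its values
    are the partial derivatives found above.\<close>
  have "(a, w) = a *\<^sub>R (1, 0) + (\<Sum>i\<in>UNIV. w $ i *\<^sub>R (0, axis i 1))"
    using basis_expansion[of w]
    by (intro prod_eqI) (simp_all add: fst_sum snd_sum scalar_mult_eq_scaleR)
  then have "D (a, w) = D (a *\<^sub>R (1, 0)) + (\<Sum>i\<in>UNIV. D (w $ i *\<^sub>R (0, axis i 1)))"
    by (simp only: add sum)
  then have "D (a, w) = a * D (1, 0) + (\<Sum>i\<in>UNIV. w $ i * D (0, axis i 1))"
    by (simp only: scaleR real_scaleR_def)
  then show ?thesis
    by (simp add: pt px inner_vec_def mult.commute)
qed

theorem proposition1:
  fixes f :: "real \<Rightarrow> real ^ 'n \<Rightarrow> real ^ 'n"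
    and g :: "real \<Rightarrow> real ^ 'n \<Rightarrow> real ^ 'm ^ 'n"
    and r V :: "real \<Rightarrow> real ^ 'n \<Rightarrow> real"
    and k :: "real \<Rightarrow> real ^ 'n \<Rightarrow> real ^ 'm"
    and t0 T \<gamma> :: real
  assumes "cont_t_lipschitz_x f" and "cont_t_lipschitz_x g"
    and "t0 \<le> T"
    and "continuous_on UNIV (\<lambda>(t, x). r t x)"
    and "C1 (\<lambda>(t, x). V t x)"
    and "cont_t_lipschitz_x k"
    and "\<And>t x. t \<in> {t0..T} \<Longrightarrow>
           partial_t V t x + partial_x V t x \<bullet> (f t x + g t x *v k t x) \<le> 0"
    and "\<And>t. t \<in> {t0..T} \<Longrightarrow> sublevel V t \<gamma> \<subseteq> sublevel r t 0"
  shows "\<forall>x0 \<phi>. x0 \<in> sublevel V t0 \<gamma> \<and> closed_loop_trajectory f g t0 T x0 k \<phi>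
           \<longrightarrow> (\<forall>t\<in>{t0..T}. \<phi> t \<in> sublevel r t 0)"
proof (intro allI impI ballI)
  fix x0 \<phi> t
  assume "x0 \<in> sublevel V t0 \<gamma> \<and> closed_loop_trajectory f g t0 T x0 k \<phi>" and t: "t \<in> {t0..T}"
  then have init: "V t0 (\<phi> t0) \<le> \<gamma>"
    and sol: "\<And>s. s \<in> {t0..T} \<Longrightarrow>
      (\<phi> has_vector_derivative (f s (\<phi> s) + g s (\<phi> s) *v k s (\<phi> s))) (at s within {t0..T})"
    by (auto simp: sublevel_def closed_loop_trajectory_def trajectory_def)
  obtain V' where V': "\<And>z. ((\<lambda>(t, x). V t x) has_derivative blinfun_apply (V' z)) (at z)"
    using assms(5) unfolding C1_def by blast
  let ?W = "\<lambda>s. partial_t V s (\<phi> s)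
    + partial_x V s (\<phi> s) \<bullet> (f s (\<phi> s) + g s (\<phi> s) *v k s (\<phi> s))"
  \<comment> \<open>The derivative is taken within \<open>{t0..t}\<close>, a subset of
    \<open>{t0..T}\<close>, because the mean value theorem is applied on that interval; it is
    one-sided at the endpoints.\<close>
  have W: "((\<lambda>s. V s (\<phi> s)) has_derivative (\<lambda>h. h * ?W s)) (at s within {t0..t})"
    if "s \<in> {t0..t}" for s
  proof -
    let ?v = "f s (\<phi> s) + g s (\<phi> s) *v k s (\<phi> s)"
    have "(\<phi> has_derivative (\<lambda>h. h *\<^sub>R ?v)) (at s within {t0..t})"
      using sol[of s] that t
      by (auto simp: has_vector_derivative_def intro: has_derivative_subset)
    then have "((\<lambda>s. (s, \<phi> s)) has_derivative (\<lambda>h. (h, h *\<^sub>R ?v))) (at s within {t0..t})"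
      by (intro has_derivative_Pair has_derivative_ident)
    from has_derivative_compose[OF this V']
    show ?thesis
      by (simp add: has_derivative_partials[OF V'] algebra_simps)
  qed
  \<comment> \<open>This form of the mean value theorem lets s be an endpoint, so the case t = t0 is
    covered.\<close>
  obtain s where s: "s \<in> {t0..t}" and "V t (\<phi> t) - V t0 (\<phi> t0) = (t - t0) * ?W s"
    using mvt_very_simple[of t0 t "\<lambda>s. V s (\<phi> s)" "\<lambda>s h. h * ?W s"] W t by auto
  \<comment> \<open>The dissipation inequality holds on the whole state space, so it applies at
    \<open>\<phi> s\<close> before anything is known about where that point lies.\<close>
  moreover have "(t - t0) * ?W s \<le> 0"
    using assms(7)[of s "\<phi> s"] s t by (intro mult_nonneg_nonpos) auto
  ultimately have "\<phi> t \<in> sublevel V t \<gamma>"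
    using init by (simp add: sublevel_def)
  then show "\<phi> t \<in> sublevel r t 0"
    using assms(8)[OF t] by blast
qed

end
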